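(* Let $n\ge 2$, $0<\alpha<1$ and $\beta=1-\alpha$. For $x,y\in\mathbb{R}^n\setminus\{0\}$ let $\theta\in[0,\pi]$ be the angle between $x$ and $y$ at the origin. Then $$k_\alpha(x,y)=\frac1\beta\sqrt{|x|^{2\beta}+|y|^{2\beta}-2|x|^\beta|y|^\beta\cos\beta\theta}.$$ In particular, as $\alpha\to 1$, $k_\alpha(x,y)\to\sqrt{\theta^2+\log^2(|x|/|y|)}$.
   Context: The $\alpha$--quasihyperbolic metric of $\mathbb{R}^n\setminus\{0\}$ is $k_\alpha(x,y)=\inf_\gamma\int_\gamma \frac{|dz|}{|z|^{\alpha}}$, the infimum taken over all rectifiable paths $\gamma$ in $\mathbb{R}^n\setminus\{0\}$ joining $x$ and $y$. *)

theory Defs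
  imports "HOL-Analysis.Analysis"
begin

definition curve_variation :: "(real \<Rightarrow> 'a::real_normed_vector) \<Rightarrow> real \<Rightarrow> real \<Rightarrow> ennreal" where
  "curve_variation g a b =
     (SUP d \<in> {d. d division_of {a..b}}. (\<Sum>K\<in>d. ennreal (norm (g (Sup K) - g (Inf K)))))"

definition rectifiable_path :: "(real \<Rightarrow> 'a::real_normed_vector) \<Rightarrow> bool" where
  "rectifiable_path g \<longleftrightarrow> path g \<and> curve_variation g 0 1 < \<infinity>"

definition arclength_fun :: "(real \<Rightarrow> 'a::real_normed_vector) \<Rightarrow> real \<Rightarrow> real" where
  "arclength_fun g t = enn2real (curve_variation g 0 (max 0 (min 1 t)))"

text \<open>Line integral with respect to arc length, \<open>\<integral>_g f |dz|\<close>, for nonnegative f: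
  Lebesgue--Stieltjes integral of f(g t) with respect to the arc-length function.\<close>
definition arclength_integral :: "('a::real_normed_vector \<Rightarrow> real) \<Rightarrow> (real \<Rightarrow> 'a) \<Rightarrow> ennreal" where
  "arclength_integral f g =
     (\<integral>\<^sup>+ t \<in> {0..1}. ennreal (f (g t)) \<partial>interval_measure (arclength_fun g))"

definition k_alpha :: "real \<Rightarrow> 'a::euclidean_space \<Rightarrow> 'a \<Rightarrow> real" where
  "k_alpha \<alpha> x y = enn2real (INF g \<in> {g. rectifiable_path g \<and> pathstart g = x \<and> pathfinish g = y
                                        \<and> path_image g \<subseteq> - {0}}.
                        arclength_integral (\<lambda>z. 1 / norm z powr \<alpha>) g)"

definition vangle :: "'a::real_inner \<Rightarrow> 'a \<Rightarrow> real" where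
  "vangle x y = arccos ((x \<bullet> y) / (norm x * norm y))"

end

(* The power map w \<mapsto> w^\<beta> / \<beta> on a half-plane is conformal with |dw^\<beta>| / \<beta> = |dw| / |w|^\<alpha>,
   so it flattens the metric: distances become Euclidean distances in a sector of opening at most
   \<beta> * pi, which is convex.
   Lower bound: rotating every point about the axis through x into one half-plane bounded by that axis
   is 1-Lipschitz and preserves norms, so an arbitrary path in the space reduces to a path in the closed
   half-plane, whose image under the power map is at least as long as the chord.
   Upper bound: pull the chord back, inside the plane spanned by x and y.
   Both comparisons are local estimates up to a factor q^2 with q > 1, glued by bisection. *)

theory Submission
  imports Defs "HOL-Real_Asymp.Real_Asymp"
begin

subsection \<open>Variation of curves\<close>

text \<open>The competing paths are merely rectifiable, so their integrals are Stieltjes integrals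
  against the variation and there is no velocity to substitute. What remains usable is additivity
  over half-open parameter intervals \<open>{s<..t}\<close>; hence the work on additivity of the
  variation and right-continuity of arc length. Near a fixed parameter, the weight and the
  derivative of the power map each stay within a factor q of their central values, which gives q^2;
  q tends to 1 only after gluing. The branch cut of the complex power dictates two normalisations.
  For the lower bound the half-plane is \<open>Re w \<ge> 0\<close>, which meets the cut only at 0,
  a point the path avoids. For the upper bound the bisector of the angle is the positive real axis:
  the ends of the chord have arguments plus and minus half of \<beta> \<theta>, strictly inside
  (-pi/2, pi/2) since \<beta> < 1. So the chord misses the origin even when x and y are
  opposite.\<close>

lemma sum_le_curve_variation:
  "d division_of {a..b} \<Longrightarrow> (\<Sum>K\<in>d. ennreal (norm (g (Sup K) - g (Inf K)))) \<le> curve_variation g a b"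
  unfolding curve_variation_def by (rule SUP_upper) simp

lemma division_of_real_cases:
  fixes a b :: real
  assumes "d division_of {a..b}" "K \<in> d"
  obtains l u where "K = {l..u}" "l \<le> u" "a \<le> l" "u \<le> b"
proof -
  obtain l u where K: "K = {l..u}"
    using division_ofD(4)[OF assms] by (auto simp: cbox_interval)
  moreover have "K \<noteq> {}" "K \<subseteq> {a..b}"
    using division_ofD(2,3)[OF assms] by auto
  ultimately show ?thesis
    using that by auto
qed

text \<open>Clipping a division of \<open>{a..b}\<close> to \<open>{c..e}\<close> makes some cells empty and may merge others into a
  common point; neither kind contributes to the sum.\<close>

lemma sum_clipped_le_curve_variation:
  fixes g :: "real \<Rightarrow> 'a::real_normed_vector"
  assumes d: "d division_of {a..b}" and ac: "a \<le> c" and ce: "c \<le> e" and eb: "e \<le> b"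
  shows "(\<Sum>K\<in>d. ennreal (norm (g (max c (min e (Sup K))) - g (max c (min e (Inf K))))))
           \<le> curve_variation g c e"
proof -
  define r where "r K = {c..e} \<inter> K" for K
  define h where "h K = ennreal (norm (g (Sup K) - g (Inf K)))" for K
  define d' where "d' = {K\<in>d. r K \<noteq> {}}"
  have fin: "finite d" using d by blast
  have "{{c..e} \<inter> K |K. K \<in> d \<and> {c..e} \<inter> K \<noteq> {}} division_of {c..e}"
    using division_inter_1[OF d, of c e] ac eb by (simp add: cbox_interval)
  moreover have "{{c..e} \<inter> K |K. K \<in> d \<and> {c..e} \<inter> K \<noteq> {}} = r ` d'"
    by (auto simp: d'_def r_def)
  ultimately have div: "r ` d' division_of {c..e}" by simp
  have "(\<Sum>K\<in>d. ennreal (norm (g (max c (min e (Sup K))) - g (max c (min e (Inf K))))))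
      = (\<Sum>K\<in>d'. ennreal (norm (g (max c (min e (Sup K))) - g (max c (min e (Inf K))))))"
  proof (rule sum.mono_neutral_right[OF fin])
    show "d' \<subseteq> d" by (auto simp: d'_def)
    show "\<forall>K\<in>d - d'. ennreal (norm (g (max c (min e (Sup K))) - g (max c (min e (Inf K))))) = 0"
    proof
      fix K assume K: "K \<in> d - d'"
      then obtain l u where lu: "K = {l..u}" "l \<le> u" "a \<le> l" "u \<le> b"
        using division_of_real_cases[OF d] by blast
      have "\<not> (max c l \<le> min e u)" using K lu by (auto simp: d'_def r_def)
      then have "max c (min e u) = max c (min e l)"
        using lu ce by (auto simp: max_def min_def)
      then show "ennreal (norm (g (max c (min e (Sup K))) - g (max c (min e (Inf K))))) = 0"
        using lu by simp
    qed
  qed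
  also have "\<dots> = (\<Sum>K\<in>d'. (h \<circ> r) K)"
  proof (rule sum.cong[OF refl])
    fix K assume K: "K \<in> d'"
    then obtain l u where lu: "K = {l..u}" "l \<le> u" "a \<le> l" "u \<le> b"
      using division_of_real_cases[OF d] unfolding d'_def by blast
    have r: "r K = {max c l..min e u}" using lu by (auto simp: r_def)
    have le: "max c l \<le> min e u" using K r by (auto simp: d'_def)
    have "max c (min e u) = min e u" "max c (min e l) = max c l"
      using le by (simp_all add: max_absorb2 min_absorb2)
    then show "ennreal (norm (g (max c (min e (Sup K))) - g (max c (min e (Inf K))))) = (h \<circ> r) K"
      using r le lu by (simp add: h_def)
  qed
  also have "\<dots> = sum h (r ` d')"
  proof (rule sum.reindex_nontrivial[symmetric])
    show "finite d'" using fin by (simp add: d'_def)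
    fix K L assume KL: "K \<in> d'" "L \<in> d'" "K \<noteq> L" "r K = r L"
    then obtain l u where lu: "K = {l..u}" "l \<le> u" "a \<le> l" "u \<le> b"
      using division_of_real_cases[OF d] unfolding d'_def by blast
    have r: "r K = {max c l..min e u}" using lu by (auto simp: r_def)
    have le: "max c l \<le> min e u" using KL(1) r by (auto simp: d'_def)
    have "interior K \<inter> interior L = {}"
      using division_ofD(5)[OF d, of K L] KL by (auto simp: d'_def)
    moreover have "r K \<subseteq> K" "r K \<subseteq> L" using KL(4) by (auto simp: r_def)
    ultimately have "interior (r K) = {}" by (meson disjoint_iff interior_mono subsetD subset_empty subsetI)
    then have "max c l = min e u" using le unfolding r by (simp add: interior_atLeastAtMost_real)
    then show "h (r K) = 0" unfolding r h_def by simp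
  qed
  also have "\<dots> \<le> curve_variation g c e"
    unfolding h_def by (rule sum_le_curve_variation[OF div])
  finally show ?thesis .
qed

lemma norm_diff_le_curve_variation:
  assumes "a \<le> b"
  shows "ennreal (norm (g b - g a)) \<le> curve_variation g a b"
  using sum_le_curve_variation[of "{{a..b}}" a b g] division_of_self[of a b] assms
  by (simp add: cbox_interval)

text \<open>Divisions of the two halves unite to a division of the whole; the two suprema are then
  taken one after the other.\<close>

lemma curve_variation_superadditive:
  assumes "a \<le> c" "c \<le> b"
  shows "curve_variation g a c + curve_variation g c b \<le> curve_variation g a b"
proof -
  have sums_le: "(\<Sum>K\<in>p. ennreal (norm (g (Sup K) - g (Inf K)))) + (\<Sum>K\<in>q. ennreal (norm (g (Sup K) - g (Inf K))))
          \<le> curve_variation g a b"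
    if p: "p division_of {a..c}" and q: "q division_of {c..b}" for p q
  proof -
    have "(p \<union> q) division_of ({a..c} \<union> {c..b})"
      by (rule division_disjoint_union[OF p q]) (simp add: interior_atLeastAtMost_real disjoint_iff)
    moreover have "{a..c} \<union> {c..b} = {a..b}" using assms by auto
    ultimately have pq: "(p \<union> q) division_of {a..b}" by simp
    \<comment> \<open>The two divisions can share only the degenerate cell at \<open>c\<close>, so
      the sum over the union loses nothing.\<close>
    have "(\<Sum>K\<in>p \<inter> q. ennreal (norm (g (Sup K) - g (Inf K)))) = 0"
    proof (rule sum.neutral, rule ballI)
      fix K assume K: "K \<in> p \<inter> q"
      obtain l u where "K = {l..u}" "l \<le> u" "a \<le> l" "u \<le> c"
        using division_of_real_cases[OF p, of K] K by blast
      moreover have "K \<subseteq> {c..b}" using division_ofD(2)[OF q, of K] K by auto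
      ultimately have "l = u" by auto
      then show "ennreal (norm (g (Sup K) - g (Inf K))) = 0" using \<open>K = {l..u}\<close> by simp
    qed
    moreover have "finite p" "finite q"
      by (rule division_of_finite[OF p], rule division_of_finite[OF q])
    ultimately show ?thesis
      using sum.union_inter[of p q "\<lambda>K. ennreal (norm (g (Sup K) - g (Inf K)))"]
        sum_le_curve_variation[OF pq, of g] by simp
  qed
  obtain p q where "p division_of {a..c}" "q division_of {c..b}"
    using elementary_interval[of a c] elementary_interval[of c b] unfolding cbox_interval by metis
  then have ne: "{p. p division_of {a..c}} \<noteq> {}" "{p. p division_of {c..b}} \<noteq> {}"
    by auto
  have "(\<Sum>K\<in>p. ennreal (norm (g (Sup K) - g (Inf K)))) + curve_variation g c b \<le> curve_variation g a b"
    if "p division_of {a..c}" for p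
    unfolding curve_variation_def[of g c b] ennreal_SUP_add_right[OF ne(2)]
    using sums_le[OF that] by (intro SUP_least) simp
  then show ?thesis
    unfolding curve_variation_def[of g a c] ennreal_SUP_add_left[OF ne(1), symmetric]
    by (intro SUP_least) simp
qed

text \<open>Every cell of a division is clipped to both sides of \<open>c\<close>. Only a cell
  straddling \<open>c\<close> needs the triangle inequality; for any other cell one of the two
  clipped increments vanishes.\<close>

lemma curve_variation_subadditive:
  fixes g :: "real \<Rightarrow> 'a::real_normed_vector"
  assumes "a \<le> c" "c \<le> b"
  shows "curve_variation g a b \<le> curve_variation g a c + curve_variation g c b"
  unfolding curve_variation_def[of g a b]
proof (rule SUP_least)
  fix d assume "d \<in> {d. d division_of {a..b}}"
  then have d: "d division_of {a..b}" by simp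
  have "(\<Sum>K\<in>d. ennreal (norm (g (Sup K) - g (Inf K))))
      \<le> (\<Sum>K\<in>d. ennreal (norm (g (max a (min c (Sup K))) - g (max a (min c (Inf K)))))
             + ennreal (norm (g (max c (min b (Sup K))) - g (max c (min b (Inf K))))))"
  proof (rule sum_mono)
    fix K assume "K \<in> d"
    then obtain l u where lu: "K = {l..u}" "l \<le> u" "a \<le> l" "u \<le> b"
      using division_of_real_cases[OF d] by blast
    have m: "max a (min c u) = min c u" "max a (min c l) = min c l"
        "max c (min b u) = max c u" "max c (min b l) = max c l"
      using lu assms by (auto simp: max_def min_def)
    have "norm (g u - g l) \<le> norm (g (min c u) - g (min c l)) + norm (g (max c u) - g (max c l))"
    proof -
      consider "l \<le> c" "c \<le> u" | "u < c" | "c < l" by linarith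
      then show ?thesis
      proof cases
        case 1
        then show ?thesis
          using norm_triangle_ineq[of "g c - g l" "g u - g c"] by simp
      qed (use lu in simp_all)
    qed
    then show "ennreal (norm (g (Sup K) - g (Inf K))) \<le>
        ennreal (norm (g (max a (min c (Sup K))) - g (max a (min c (Inf K)))))
             + ennreal (norm (g (max c (min b (Sup K))) - g (max c (min b (Inf K)))))"
      using lu by (simp add: m ennreal_plus[symmetric] del: ennreal_plus)
  qed
  also have "\<dots> \<le> curve_variation g a c + curve_variation g c b"
    unfolding sum.distrib using assms
    by (intro add_mono sum_clipped_le_curve_variation[OF d]) auto
  finally show "(\<Sum>K\<in>d. ennreal (norm (g (Sup K) - g (Inf K))))
      \<le> curve_variation g a c + curve_variation g c b" .
qed

lemma curve_variation_add:
  assumes "a \<le> c" "c \<le> b"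
  shows "curve_variation g a c + curve_variation g c b = curve_variation g a b"
  using assms by (intro antisym curve_variation_superadditive curve_variation_subadditive)

lemma curve_variation_Lipschitz:
  fixes g :: "real \<Rightarrow> 'a::real_normed_vector"
  assumes "a \<le> b"
    and L: "\<And>s t. a \<le> s \<Longrightarrow> s \<le> t \<Longrightarrow> t \<le> b \<Longrightarrow> norm (g t - g s) \<le> L * (t - s)"
  shows "curve_variation g a b \<le> ennreal (L * (b - a))"
  unfolding curve_variation_def
proof (rule SUP_least)
  fix d assume "d \<in> {d. d division_of {a..b}}"
  then have d: "d division_of {a..b}" by simp
  have "(\<Sum>K\<in>d. norm (g (Sup K) - g (Inf K))) \<le> (\<Sum>K\<in>d. L * measure lborel K)"
  proof (rule sum_mono)
    fix K assume "K \<in> d"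
    then obtain l u where lu: "K = {l..u}" "l \<le> u" "a \<le> l" "u \<le> b"
      using division_of_real_cases[OF d] by blast
    then show "norm (g (Sup K) - g (Inf K)) \<le> L * measure lborel K"
      using L[of l u] by simp
  qed
  also have "\<dots> = L * (b - a)"
    using additive_content_division[of d a b] d assms(1)
    by (simp add: cbox_interval flip: sum_distrib_left)
  finally show "(\<Sum>K\<in>d. ennreal (norm (g (Sup K) - g (Inf K)))) \<le> ennreal (L * (b - a))"
    by (simp add: sum_ennreal ennreal_leI)
qed

text \<open>For a fixed division the clipped sum is continuous in the left end point, so the variation over
  \<open>{c..b}\<close> is lower semicontinuous in \<open>c\<close>; by additivity the variation over \<open>{s..c}\<close> is then small.\<close>

lemma curve_variation_right_continuous:
  fixes g :: "real \<Rightarrow> 'a::real_normed_vector"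
  assumes cont: "continuous_on {s..b} g" and sb: "s < b"
    and fin: "curve_variation g s b < \<infinity>" and "e > 0"
  shows "eventually (\<lambda>c. curve_variation g s c < ennreal e) (at_right s)"
proof (cases "curve_variation g s b = 0")
  case True
  have "curve_variation g s c = 0" if "s < c" "c < b" for c
    using curve_variation_add[of s c b g] that True by simp
  then show ?thesis
    using sb \<open>e > 0\<close> by (intro eventually_at_rightI[of s b]) simp_all
next
  case False
  obtain v where v: "curve_variation g s b = ennreal v" "v > 0"
    using fin False by (cases "curve_variation g s b") (auto simp: ennreal_eq_0_iff not_le)
  define S where "S d c = (\<Sum>K\<in>d. norm (g (max c (min b (Sup K))) - g (max c (min b (Inf K)))))" for d c
  \<comment> \<open>This is why zero variation is a separate case: \<open>ennreal\<close> truncates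
    negative numbers to 0, so strictness requires \<open>v > 0\<close>.\<close>
  have "ennreal (v - e / 2) < curve_variation g s b"
    using v \<open>e > 0\<close> by (simp add: ennreal_less_iff ennreal_lessI)
  then obtain d where d: "d division_of {s..b}"
      and Sd: "ennreal (v - e / 2) < (\<Sum>K\<in>d. ennreal (norm (g (Sup K) - g (Inf K))))"
    unfolding curve_variation_def less_SUP_iff by auto
  have "(\<Sum>K\<in>d. norm (g (Sup K) - g (Inf K))) = S d s"
    unfolding S_def
  proof (rule sum.cong[OF refl])
    fix K assume "K \<in> d"
    then obtain l u where lu: "K = {l..u}" "l \<le> u" "s \<le> l" "u \<le> b"
      using division_of_real_cases[OF d] by blast
    then show "norm (g (Sup K) - g (Inf K)) = norm (g (max s (min b (Sup K))) - g (max s (min b (Inf K))))"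
      by (simp add: max_def min_def)
  qed
  then have "ennreal (v - e / 2) < ennreal (S d s)"
    using Sd by (simp add: sum_ennreal)
  then have Ss: "v - e / 2 < S d s"
    by (meson ennreal_leI not_le)
  have "continuous_on {s..b} (S d)"
    unfolding S_def
    by (intro continuous_intros continuous_on_compose2[OF cont]) (use sb in auto)
  then have "(S d \<longlongrightarrow> S d s) (at_right s)"
    using sb by (auto simp: continuous_on_def simp flip: at_within_Icc_at_right[OF sb])
  then have "eventually (\<lambda>c. v - e / 2 < S d c) (at_right s)"
    using Ss by (rule order_tendstoD)
  moreover have "eventually (\<lambda>c. s < c \<and> c < b) (at_right s)"
    by (rule eventually_at_rightI[OF _ sb]) simp
  ultimately show ?thesis
  proof eventually_elim
    case (elim c)
    have add: "curve_variation g s c + curve_variation g c b = ennreal v"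
      using curve_variation_add[of s c b g] elim v by simp
    obtain p where p: "curve_variation g s c = ennreal p" "p \<ge> 0"
      using add by (cases "curve_variation g s c") auto
    obtain q where q: "curve_variation g c b = ennreal q" "q \<ge> 0"
      using add by (cases "curve_variation g c b") auto
    have "ennreal (S d c) \<le> ennreal q"
      using sum_clipped_le_curve_variation[OF d, of c b g] elim q
      by (simp add: S_def sum_ennreal)
    then have "S d c \<le> q" using q by (simp add: ennreal_le_iff)
    moreover have "p + q = v" 
      using add v p q by (simp add: ennreal_plus[symmetric] del: ennreal_plus)
    ultimately have "p < e" using elim \<open>e > 0\<close> by simp
    then show ?case using p by (simp add: ennreal_less_iff)
  qed
qed

subsection \<open>The arc length measure\<close>

lemma curve_variation_mono:
  assumes "a \<le> c" "c \<le> e" "e \<le> b"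
  shows "curve_variation g c e \<le> curve_variation g a b"
proof -
  have "curve_variation g c e \<le> curve_variation g a e"
    using assms by (subst curve_variation_add[of a c e g, symmetric]) (auto intro: add_increasing)
  also have "\<dots> \<le> curve_variation g a b"
    using assms by (subst curve_variation_add[of a e b g, symmetric]) (auto intro: add_increasing2)
  finally show ?thesis .
qed

lemma ennreal_arclength_fun:
  assumes "rectifiable_path g" "0 \<le> t" "t \<le> 1"
  shows "ennreal (arclength_fun g t) = curve_variation g 0 t"
proof -
  have "curve_variation g 0 t < \<infinity>"
    using curve_variation_mono[of 0 0 t 1 g] assms by (auto simp: rectifiable_path_def)
  then show ?thesis
    using assms by (simp add: arclength_fun_def)
qed

lemma arclength_fun_diff:
  assumes g: "rectifiable_path g" and "0 \<le> s" "s \<le> t" "t \<le> 1"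
  shows "ennreal (arclength_fun g t - arclength_fun g s) = curve_variation g s t"
proof -
  have "curve_variation g 0 s + curve_variation g s t = curve_variation g 0 t"
    using assms by (intro curve_variation_add)
  then have *: "ennreal (arclength_fun g s) + curve_variation g s t = ennreal (arclength_fun g t)"
    using assms by (simp add: ennreal_arclength_fun)
  have nn: "0 \<le> arclength_fun g u" for u by (simp add: arclength_fun_def)
  obtain v where v: "curve_variation g s t = ennreal v" "v \<ge> 0"
    using * by (cases "curve_variation g s t") auto
  then have "arclength_fun g s + v = arclength_fun g t"
    using * nn by (simp add: ennreal_plus[symmetric] del: ennreal_plus)
  then show ?thesis using v by (simp add: algebra_simps)
qed

lemma mono_arclength_fun:
  assumes g: "rectifiable_path g" and "s \<le> t"
  shows "arclength_fun g s \<le> arclength_fun g t"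
proof -
  have "curve_variation g 0 (max 0 (min 1 t)) < \<infinity>"
    using curve_variation_mono[of 0 0 "max 0 (min 1 t)" 1 g] g by (auto simp: rectifiable_path_def)
  then show ?thesis
    unfolding arclength_fun_def using \<open>s \<le> t\<close>
    by (intro enn2real_mono curve_variation_mono) auto
qed

text \<open>\<open>interval_measure\<close> gives \<open>{s<..t}\<close> the mass
  \<open>F t - F s\<close> only for right-continuous monotone \<open>F\<close>. Outside the unit
  interval the clamping makes the function locally constant to the right; inside, continuity of the
  path is what counts.\<close>

lemma arclength_fun_right_continuous:
  assumes g: "rectifiable_path g"
  shows "continuous (at_right s) (arclength_fun g)"
proof -
  consider "s < 0" | "0 \<le> s" "s < 1" | "1 \<le> s" by linarith
  then show ?thesis
  proof cases
    case 1
    have "eventually (\<lambda>c. arclength_fun g c = arclength_fun g s) (at_right s)"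
      by (rule eventually_at_rightI[of s 0]) (use 1 in \<open>simp_all add: arclength_fun_def\<close>)
    then show ?thesis
      unfolding continuous_within by (rule tendsto_eventually)
  next
    case 3
    have "eventually (\<lambda>c. arclength_fun g c = arclength_fun g s) (at_right s)"
      by (rule eventually_at_rightI[of s "s + 1"]) (use 3 in \<open>simp_all add: arclength_fun_def\<close>)
    then show ?thesis
      unfolding continuous_within by (rule tendsto_eventually)
  next
    case 2
    show ?thesis
      unfolding continuous_within
    proof (rule tendstoI)
      fix e :: real assume "e > 0"
      have "continuous_on {s..1} g"
        using g 2 unfolding rectifiable_path_def path_def by (auto elim: continuous_on_subset)
      moreover have "curve_variation g s 1 < \<infinity>"
        using curve_variation_mono[of 0 s 1 1 g] g 2 by (auto simp: rectifiable_path_def)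
      ultimately have "eventually (\<lambda>c. curve_variation g s c < ennreal e) (at_right s)"
        using 2 \<open>e > 0\<close> by (intro curve_variation_right_continuous[of s 1])
      moreover have "eventually (\<lambda>c. s < c \<and> c < 1) (at_right s)"
        by (rule eventually_at_rightI[of s 1]) (use 2 in simp_all)
      ultimately show "eventually (\<lambda>c. dist (arclength_fun g c) (arclength_fun g s) < e) (at_right s)"
      proof eventually_elim
        case (elim c)
        have "ennreal (arclength_fun g c - arclength_fun g s) < ennreal e"
          using elim 2 by (subst arclength_fun_diff[OF g]) auto
        then show ?case
          using mono_arclength_fun[OF g, of s c] elim by (simp add: dist_real_def ennreal_less_iff)
      qed
    qed
  qed
qed

lemma emeasure_arclength_Ioc:
  assumes g: "rectifiable_path g" and "0 \<le> s" "s \<le> t" "t \<le> 1"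
  shows "emeasure (interval_measure (arclength_fun g)) {s<..t} = curve_variation g s t"
  using emeasure_interval_measure_Ioc[of s t "arclength_fun g"] arclength_fun_diff[OF assms]
    mono_arclength_fun[OF g] arclength_fun_right_continuous[OF g] assms by simp

text \<open>Clamping makes arc length constant on the negative axis and at 0, so there is no atom at
  0. The closed interval in \<open>arclength_integral\<close> may thus be replaced by
  \<open>{0<..1}\<close>, which can be cut into half-open pieces.\<close>

lemma emeasure_arclength_0:
  assumes g: "rectifiable_path g"
  shows "emeasure (interval_measure (arclength_fun g)) {0} = 0"
proof -
  have "emeasure (interval_measure (arclength_fun g)) {0} \<le> emeasure (interval_measure (arclength_fun g)) {-1<..0}"
    by (intro emeasure_mono) auto
  also have "\<dots> = ennreal (arclength_fun g 0 - arclength_fun g (-1))"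
    by (intro emeasure_interval_measure_Ioc mono_arclength_fun arclength_fun_right_continuous g) simp
  also have "\<dots> = 0" by (simp add: arclength_fun_def)
  finally show ?thesis by simp
qed

text \<open>Treating the line integral as a measure on the parameter makes its additivity under
  cutting automatic. The indicator keeps the density measurable although nothing is known about
  \<open>g\<close> outside the unit interval.\<close>

definition weighted_arclength :: "('a::real_normed_vector \<Rightarrow> real) \<Rightarrow> (real \<Rightarrow> 'a) \<Rightarrow> real measure" where
  "weighted_arclength f g =
     density (interval_measure (arclength_fun g)) (\<lambda>t. ennreal (f (g t)) * indicator {0..1} t)"

lemma weighted_arclength_measurable:
  fixes g :: "real \<Rightarrow> 'a::real_normed_vector"
  assumes "continuous_on (path_image g) f" "path g"
  shows "(\<lambda>t. ennreal (f (g t)) * indicator {0..1} t) \<in> borel_measurable (interval_measure F)"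
proof -
  have "continuous_on {0..1} (\<lambda>t. f (g t))"
    using assms unfolding path_def path_image_def
    by (auto intro: continuous_on_compose2)
  then have "(\<lambda>t. indicator {0..1} t *\<^sub>R f (g t)) \<in> borel_measurable borel"
    by (intro borel_measurable_continuous_on_indicator) auto
  then have "(\<lambda>t. ennreal (indicator {0..1} t *\<^sub>R f (g t))) \<in> borel_measurable borel"
    by simp
  also have "(\<lambda>t. ennreal (indicator {0..1} t *\<^sub>R f (g t))) = (\<lambda>t. ennreal (f (g t)) * indicator {0..1} t)"
    by (auto simp: indicator_def)
  finally show ?thesis by simp
qed

lemma emeasure_weighted_arclength:
  fixes g :: "real \<Rightarrow> 'a::real_normed_vector"
  assumes "continuous_on (path_image g) f" "path g" "0 \<le> s" "t \<le> 1"
  shows "emeasure (weighted_arclength f g) {s<..t}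
           = (\<integral>\<^sup>+ u \<in> {s<..t}. ennreal (f (g u)) \<partial>interval_measure (arclength_fun g))"
  unfolding weighted_arclength_def
  by (subst emeasure_density[OF weighted_arclength_measurable])
     (use assms in \<open>auto intro!: nn_integral_cong simp: indicator_def\<close>)

lemma arclength_integral_eq:
  fixes g :: "real \<Rightarrow> 'a::real_normed_vector"
  assumes f: "continuous_on (path_image g) f" and g: "rectifiable_path g"
  shows "arclength_integral f g = emeasure (weighted_arclength f g) {0<..1}"
proof -
  have p: "path g" using g by (simp add: rectifiable_path_def)
  have "AE t in interval_measure (arclength_fun g). t \<noteq> 0"
    by (rule AE_I[of _ _ "{0}"]) (auto simp: emeasure_arclength_0[OF g])
  then have "arclength_integral f g
      = (\<integral>\<^sup>+ u \<in> {0<..1}. ennreal (f (g u)) \<partial>interval_measure (arclength_fun g))"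
    unfolding arclength_integral_def
    by (intro nn_integral_cong_AE) (auto simp: indicator_def)
  then show ?thesis
    using emeasure_weighted_arclength[OF f p, of 0 1] by simp
qed

lemma emeasure_weighted_arclength_add:
  assumes "s \<le> t" "t \<le> u"
  shows "emeasure (weighted_arclength f g) {s<..t} + emeasure (weighted_arclength f g) {t<..u}
           = emeasure (weighted_arclength f g) {s<..u}"
  by (subst plus_emeasure) (use assms in \<open>auto simp: weighted_arclength_def ivl_disj_un\<close>)

lemma emeasure_weighted_arclength_ge:
  fixes g :: "real \<Rightarrow> 'a::real_normed_vector"
  assumes f: "continuous_on (path_image g) f" and g: "rectifiable_path g"
    and st: "0 \<le> s" "s \<le> t" "t \<le> 1"
    and m: "\<And>u. s \<le> u \<Longrightarrow> u \<le> t \<Longrightarrow> m \<le> f (g u)"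
  shows "ennreal m * curve_variation g s t \<le> emeasure (weighted_arclength f g) {s<..t}"
proof -
  have "ennreal m * curve_variation g s t
      = (\<integral>\<^sup>+ u \<in> {s<..t}. ennreal m \<partial>interval_measure (arclength_fun g))"
    by (subst nn_integral_cmult_indicator) (simp_all add: emeasure_arclength_Ioc[OF g st])
  also have "\<dots> \<le> (\<integral>\<^sup>+ u \<in> {s<..t}. ennreal (f (g u)) \<partial>interval_measure (arclength_fun g))"
    by (intro nn_integral_mono) (auto simp: indicator_def intro!: ennreal_leI m)
  finally show ?thesis
    using emeasure_weighted_arclength[OF f, of s t] g st by (simp add: rectifiable_path_def)
qed

lemma emeasure_weighted_arclength_le:
  fixes g :: "real \<Rightarrow> 'a::real_normed_vector"
  assumes f: "continuous_on (path_image g) f" and g: "rectifiable_path g"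
    and st: "0 \<le> s" "s \<le> t" "t \<le> 1"
    and m: "\<And>u. s \<le> u \<Longrightarrow> u \<le> t \<Longrightarrow> f (g u) \<le> m"
  shows "emeasure (weighted_arclength f g) {s<..t} \<le> ennreal m * curve_variation g s t"
proof -
  have "(\<integral>\<^sup>+ u \<in> {s<..t}. ennreal (f (g u)) \<partial>interval_measure (arclength_fun g))
      \<le> (\<integral>\<^sup>+ u \<in> {s<..t}. ennreal m \<partial>interval_measure (arclength_fun g))"
    by (intro nn_integral_mono) (auto simp: indicator_def intro!: ennreal_leI m)
  also have "\<dots> = ennreal m * curve_variation g s t"
    by (subst nn_integral_cmult_indicator) (simp_all add: emeasure_arclength_Ioc[OF g st])
  finally show ?thesis
    using emeasure_weighted_arclength[OF f, of s t] g st by (simp add: rectifiable_path_def)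
qed

subsection \<open>Complex powers on the right half-plane\<close>

text \<open>The range of \<open>t\<close> makes \<open>Complex (ln r) t\<close> the principal
  logarithm; the exponent \<open>b\<close> is arbitrary, so the formula serves both for \<beta> and
  for its inverse.\<close>

lemma powr_of_real_mult_cis:
  assumes "r > 0" "-pi < t" "t \<le> pi"
  shows "(of_real r * cis t) powr of_real b = of_real (r powr b) * cis (b * t)"
proof -
  have "of_real r * cis t = exp (Complex (ln r) t)"
    using assms by (simp add: exp_eq_polar)
  then have "Ln (of_real r * cis t) = Complex (ln r) t"
    using assms by (simp add: Ln_exp)
  then have "(of_real r * cis t) powr of_real b = exp (of_real b * Complex (ln r) t)"
    using assms by (simp add: powr_def)
  also have "\<dots> = of_real (r powr b) * cis (b * t)"
    using assms by (simp add: exp_eq_polar powr_def)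
  finally show ?thesis .
qed

text \<open>Mean value inequality on a convex set off the branch cut. It is applied with exponent
  \<beta> to flatten a path and with 1/\<beta> to pull the chord back.\<close>

lemma norm_diff_powr_le:
  fixes S :: "complex set" and p :: real
  assumes "convex S" "S \<inter> \<real>\<^sub>\<le>\<^sub>0 = {}"
    and C: "\<And>w. w \<in> S \<Longrightarrow> norm w powr (p - 1) \<le> C"
    and "w \<in> S" "w' \<in> S"
  shows "norm (w powr of_real p - w' powr of_real p) \<le> \<bar>p\<bar> * C * norm (w - w')"
proof (rule field_differentiable_bound[OF \<open>convex S\<close> _ _ \<open>w \<in> S\<close> \<open>w' \<in> S\<close>])
  fix z assume z: "z \<in> S"
  then have "z \<notin> \<real>\<^sub>\<le>\<^sub>0" using assms by auto
  then show "((\<lambda>z. z powr of_real p) has_field_derivative of_real p * z powr (of_real p - 1)) (at z within S)"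
    by (rule has_field_derivative_at_within[OF has_field_derivative_powr])
  have "norm (z powr (of_real p - 1)) = norm z powr (p - 1)"
    by (subst norm_powr_real_powr') auto
  then show "norm (of_real p * z powr (of_real p - 1)) \<le> \<bar>p\<bar> * C"
    using C[OF z] by (simp add: norm_mult mult_left_mono)
qed

lemma norm_diff_polar:
  assumes "a \<ge> 0" "b \<ge> 0"
  shows "norm (of_real a * cis s - of_real b * cis t) = sqrt (a\<^sup>2 + b\<^sup>2 - 2 * a * b * cos (s - t))"
proof -
  have "(a * cos s - b * cos t)\<^sup>2 + (a * sin s - b * sin t)\<^sup>2
      = a\<^sup>2 * ((sin s)\<^sup>2 + (cos s)\<^sup>2) + b\<^sup>2 * ((sin t)\<^sup>2 + (cos t)\<^sup>2) - 2 * a * b * cos (s - t)"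
    unfolding cos_diff by algebra
  then show ?thesis
    by (simp add: cmod_def)
qed

text \<open>Continuity is put as a ratio because a multiplicative error passes unchanged through
  sums over pieces, however many pieces there are.\<close>

lemma continuous_pos_ratio_near:
  fixes k :: "'a::metric_space \<Rightarrow> real"
  assumes "isCont k w0" "k w0 > 0" "q > 1"
  obtains d where "d > 0" "\<And>w. dist w w0 < d \<Longrightarrow> k w0 / q < k w \<and> k w < q * k w0"
proof -
  have "k w0 / q < k w0" "k w0 < q * k w0"
    using assms by (simp_all add: field_simps)
  then have "eventually (\<lambda>w. k w0 / q < k w \<and> k w < q * k w0) (nhds w0)"
    using assms(1) unfolding isCont_def tendsto_at_iff_tendsto_nhds
    by (intro eventually_conj) (auto dest: order_tendstoD)
  then show ?thesis
    using that unfolding eventually_nhds_metric by blast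
qed

lemma ennreal_le_of_le_mult_gt_1:
  fixes a L :: ennreal
  assumes "\<And>q::real. q > 1 \<Longrightarrow> a \<le> ennreal (q * q) * L"
  shows "a \<le> L"
proof (cases L)
  case (real l)
  \<comment> \<open>The single value q = 2 already shows that \<open>a\<close> is finite; the limit
    q to 1 can then be taken in the reals.\<close>
  then have "a \<le> ennreal (2 * 2 * l)"
    using assms[of 2] by (simp add: ennreal_mult)
  then obtain r where r: "a = ennreal r" "r \<ge> 0"
    by (cases a) (auto simp: top_unique)
  have "r \<le> q * q * l" if "q > 1" for q
    using assms[OF that] that r real by (simp add: ennreal_le_iff flip: ennreal_mult)
  then have "eventually (\<lambda>q. r \<le> q * q * l) (at_right 1)"
    by (intro eventually_at_rightI[of 1 2]) simp_all
  moreover have "((\<lambda>q. q * q * l) \<longlongrightarrow> 1 * 1 * l) (at_right 1)"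
    by (intro tendsto_intros)
  ultimately have "r \<le> 1 * 1 * l"
    by (intro tendsto_lowerbound) auto
  then show ?thesis using r real by (simp add: ennreal_leI)
qed simp

subsection \<open>The lower bound\<close>

text \<open>Rotating \<open>z\<close> about the axis \<open>u\<close> into a half-plane; the axis becomes the imaginary axis, not the
  real one, so that the complex powers below stay away from the branch cut.\<close>

definition half_plane_map :: "'a::real_inner \<Rightarrow> 'a \<Rightarrow> complex" where
  "half_plane_map u z = Complex (norm (z - (z \<bullet> u) *\<^sub>R u)) (z \<bullet> u)"

lemma norm_perp_component:
  assumes "norm u = 1"
  shows "(norm (z - (z \<bullet> u) *\<^sub>R u))\<^sup>2 = (norm z)\<^sup>2 - (z \<bullet> u)\<^sup>2"
proof -
  have "u \<bullet> u = 1" using assms by (simp add: dot_square_norm)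
  then show ?thesis
    unfolding power2_norm_eq_inner inner_diff_left inner_diff_right
    by (simp add: inner_commute power2_eq_square)
qed

lemma norm_half_plane_map:
  assumes "norm u = 1"
  shows "norm (half_plane_map u z) = norm z"
  by (simp add: half_plane_map_def cmod_def norm_perp_component[OF assms])

text \<open>By Pythagoras: the axial components differ by the same amount before and after, and the
  reverse triangle inequality handles the lengths of the perpendicular ones.\<close>

lemma norm_half_plane_map_diff_le:
  assumes "norm u = 1"
  shows "norm (half_plane_map u z - half_plane_map u w) \<le> norm (z - w)"
proof -
  have "\<bar>norm (z - (z \<bullet> u) *\<^sub>R u) - norm (w - (w \<bullet> u) *\<^sub>R u)\<bar>
      \<le> norm ((z - (z \<bullet> u) *\<^sub>R u) - (w - (w \<bullet> u) *\<^sub>R u))"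
    by (rule norm_triangle_ineq3)
  also have "(z - (z \<bullet> u) *\<^sub>R u) - (w - (w \<bullet> u) *\<^sub>R u) = (z - w) - ((z - w) \<bullet> u) *\<^sub>R u"
    by (simp add: algebra_simps inner_diff_left)
  finally have "(norm (z - (z \<bullet> u) *\<^sub>R u) - norm (w - (w \<bullet> u) *\<^sub>R u))\<^sup>2
      \<le> (norm ((z - w) - ((z - w) \<bullet> u) *\<^sub>R u))\<^sup>2"
    by (subst power2_le_iff_abs_le) auto
  then have "(norm (z - (z \<bullet> u) *\<^sub>R u) - norm (w - (w \<bullet> u) *\<^sub>R u))\<^sup>2 + (z \<bullet> u - w \<bullet> u)\<^sup>2 \<le> (norm (z - w))\<^sup>2"
    unfolding norm_perp_component[OF assms] by (simp add: inner_diff_left)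
  then show ?thesis
    by (simp add: half_plane_map_def cmod_def real_sqrt_le_iff' real_le_lsqrt)
qed

lemma cos_vangle:
  assumes "x \<noteq> 0" "y \<noteq> 0"
  shows "cos (vangle x y) = (x \<bullet> y) / (norm x * norm y)"
proof -
  have "\<bar>(x \<bullet> y) / (norm x * norm y)\<bar> \<le> 1"
    using Cauchy_Schwarz_ineq2[of x y] assms by (simp add: abs_mult divide_le_eq)
  then show ?thesis unfolding vangle_def by (intro cos_arccos_abs)
qed

lemma vangle_bounds:
  assumes "x \<noteq> 0" "y \<noteq> 0"
  shows "0 \<le> vangle x y" "vangle x y \<le> pi"
proof -
  have "\<bar>(x \<bullet> y) / (norm x * norm y)\<bar> \<le> 1"
    using Cauchy_Schwarz_ineq2[of x y] assms by (simp add: abs_mult divide_le_eq)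
  then have "-1 \<le> (x \<bullet> y) / (norm x * norm y)" "(x \<bullet> y) / (norm x * norm y) \<le> 1"
    unfolding abs_le_iff by linarith+
  then show "0 \<le> vangle x y" "vangle x y \<le> pi"
    unfolding vangle_def by (rule arccos_lbound, rule arccos_ubound)
qed

lemma
  assumes "x \<noteq> 0" "y \<noteq> 0"
  defines "u \<equiv> x /\<^sub>R norm x"
  shows inner_eq_norm_cos_vangle: "y \<bullet> u = norm y * cos (vangle x y)"
    and norm_perp_eq_norm_sin_vangle: "norm (y - (y \<bullet> u) *\<^sub>R u) = norm y * sin (vangle x y)"
proof -
  show c: "y \<bullet> u = norm y * cos (vangle x y)"
    using assms by (simp add: cos_vangle inner_commute divide_simps)
  have u: "norm u = 1" using assms by simp
  have "(norm (y - (y \<bullet> u) *\<^sub>R u))\<^sup>2 = (norm y)\<^sup>2 - (y \<bullet> u)\<^sup>2"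
    by (rule norm_perp_component[OF u])
  also have "\<dots> = (norm y * sin (vangle x y))\<^sup>2"
    unfolding c by (simp add: power_mult_distrib sin_squared_eq algebra_simps)
  finally have "(norm (y - (y \<bullet> u) *\<^sub>R u))\<^sup>2 = (norm y * sin (vangle x y))\<^sup>2" .
  moreover have "0 \<le> norm y * sin (vangle x y)"
    using vangle_bounds[OF assms(1,2)] by (simp add: sin_ge_zero)
  ultimately show "norm (y - (y \<bullet> u) *\<^sub>R u) = norm y * sin (vangle x y)"
    by (simp add: power2_eq_iff_nonneg)
qed

text \<open>The axis direction has argument pi/2, and the angle to it is measured downwards from
  there. All arguments therefore lie in [-pi/2, pi/2], where the principal power multiplies them by
  its exponent.\<close>

lemma half_plane_map_eq_polar:
  assumes "x \<noteq> 0" "y \<noteq> 0"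
  shows "half_plane_map (x /\<^sub>R norm x) y = of_real (norm y) * cis (pi / 2 - vangle x y)"
  unfolding half_plane_map_def norm_perp_eq_norm_sin_vangle[OF assms]
  unfolding inner_eq_norm_cos_vangle[OF assms]
  by (simp add: complex_eq_iff sin_diff cos_diff)

lemma arclength_integral_ge:
  fixes g :: "real \<Rightarrow> 'a::euclidean_space"
  assumes \<alpha>: "0 < \<alpha>" "\<alpha> < 1"
    and g: "rectifiable_path g" "path_image g \<subseteq> - {0}"
    and u: "norm u = 1"
  shows "ennreal (norm (half_plane_map u (pathfinish g) powr of_real (1 - \<alpha>)
               - half_plane_map u (pathstart g) powr of_real (1 - \<alpha>)) / (1 - \<alpha>))
           \<le> arclength_integral (\<lambda>z. 1 / norm z powr \<alpha>) g"
proof -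
  define \<beta> where "\<beta> = 1 - \<alpha>"
  define f where "f = (\<lambda>z::'a. 1 / norm z powr \<alpha>)"
  define k where "k = (\<lambda>w::complex. 1 / norm w powr \<alpha>)"
  define \<gamma> where "\<gamma> t = half_plane_map u (g t)" for t
  define \<psi> where "\<psi> t = \<gamma> t powr of_real \<beta>" for t
  define \<nu> where "\<nu> = weighted_arclength f g"
  have \<beta>: "\<beta> > 0" using \<alpha> by (simp add: \<beta>_def)
  have nz: "g t \<noteq> 0" if "t \<in> {0..1}" for t
    using g that by (auto simp: path_image_def)
  have fk: "f (g t) = k (\<gamma> t)" for t
    by (simp add: f_def k_def \<gamma>_def norm_half_plane_map[OF u])
  have contg: "continuous_on {0..1} g"
    using g by (simp add: rectifiable_path_def path_def)
  have f: "continuous_on (path_image g) f"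
    unfolding f_def using g(2) by (auto intro!: continuous_intros)
  have main: "ennreal (norm (\<psi> 1 - \<psi> 0)) \<le> ennreal (q * q) * (ennreal \<beta> * emeasure \<nu> {0<..1})"
    if q: "q > 1" for q :: real
  proof -
    \<comment> \<open>The guard is needed because the local step of \<open>Bolzano\<close> ranges
      over all short intervals around a point, including those that leave the unit interval.\<close>
    define P where "P s t \<longleftrightarrow> (0 \<le> s \<and> t \<le> 1 \<longrightarrow>
        ennreal (norm (\<psi> t - \<psi> s)) \<le> ennreal (q * q * \<beta>) * emeasure \<nu> {s<..t})" for s t
    have "(0::real) \<le> 1" by simp
    then have "P 0 1"
    proof (induction rule: Bolzano)
      case (trans a b c)
      show ?case unfolding P_def
      proof
        assume *: "0 \<le> a \<and> c \<le> 1"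
        have "norm (\<psi> c - \<psi> a) \<le> norm (\<psi> b - \<psi> a) + norm (\<psi> c - \<psi> b)"
          using norm_triangle_ineq[of "\<psi> b - \<psi> a" "\<psi> c - \<psi> b"] by simp
        then have "ennreal (norm (\<psi> c - \<psi> a)) \<le> ennreal (norm (\<psi> b - \<psi> a)) + ennreal (norm (\<psi> c - \<psi> b))"
          by (simp add: ennreal_leI flip: ennreal_plus)
        also have "\<dots> \<le> ennreal (q * q * \<beta>) * emeasure \<nu> {a<..b} + ennreal (q * q * \<beta>) * emeasure \<nu> {b<..c}"
          using trans * unfolding P_def by (intro add_mono) auto
        also have "\<dots> = ennreal (q * q * \<beta>) * emeasure \<nu> {a<..c}"
          using trans unfolding \<nu>_def
          by (simp flip: distrib_left add: emeasure_weighted_arclength_add)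
        finally show "ennreal (norm (\<psi> c - \<psi> a)) \<le> ennreal (q * q * \<beta>) * emeasure \<nu> {a<..c}" .
      qed
    next
      case (local x)
      then have gx: "\<gamma> x \<noteq> 0"
        using nz[of x] norm_half_plane_map[OF u, of "g x"] unfolding \<gamma>_def by fastforce
      have kx: "k (\<gamma> x) > 0" using gx by (simp add: k_def)
      have "isCont k (\<gamma> x)"
        unfolding k_def using gx by (intro continuous_intros) auto
      then obtain d where d: "d > 0"
          "\<And>w. dist w (\<gamma> x) < d \<Longrightarrow> k (\<gamma> x) / q < k w \<and> k w < q * k (\<gamma> x)"
        using continuous_pos_ratio_near kx q by metis
      obtain \<delta> where \<delta>: "\<delta> > 0" "\<And>t. t \<in> {0..1} \<Longrightarrow> dist t x < \<delta> \<Longrightarrow> dist (g t) (g x) < d"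
        using contg local d(1) unfolding continuous_on_iff by (metis atLeastAtMost_iff)
      have near: "dist (\<gamma> t) (\<gamma> x) < d" if "t \<in> {0..1}" "dist t x < \<delta>" for t
        using \<delta>(2)[OF that] norm_half_plane_map_diff_le[OF u, of "g t" "g x"]
        by (simp add: \<gamma>_def dist_norm)
      define S where "S = {w. Re w \<ge> 0} \<inter> ball (\<gamma> x) d"
      have "P s t" if st: "s \<le> x" "x \<le> t" "t - s < \<delta>" for s t
        unfolding P_def
      proof
        assume *: "0 \<le> s \<and> t \<le> 1"
        have near': "\<gamma> v \<in> S" "k (\<gamma> x) / q \<le> f (g v)" if v: "s \<le> v" "v \<le> t" for v
        proof -
          have n: "dist (\<gamma> v) (\<gamma> x) < d"
            using v st * by (intro near) (auto simp: dist_real_def)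
          then show "\<gamma> v \<in> S"
            by (auto simp: S_def dist_commute \<gamma>_def half_plane_map_def)
          show "k (\<gamma> x) / q \<le> f (g v)"
            using d(2)[OF n] by (simp add: fk)
        qed
        have "norm (\<psi> t - \<psi> s) \<le> \<bar>\<beta>\<bar> * (q * k (\<gamma> x)) * norm (\<gamma> t - \<gamma> s)"
          unfolding \<psi>_def
        proof (rule norm_diff_powr_le[of S])
          show "convex S"
            unfolding S_def by (intro convex_Int convex_halfspace_Re_ge convex_ball)
          \<comment> \<open>Division by zero yields 0, so \<open>k 0 = 0\<close>, while
            \<open>k\<close> is bounded below by a positive number on the ball. Thus the ball
            excludes the origin by itself.\<close>
          have "w \<noteq> 0" if "w \<in> S" for w
          proof
            assume "w = 0"
            then have "k (\<gamma> x) / q < k 0"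
              using that d(2)[of w] by (simp add: S_def dist_commute)
            moreover have "k (\<gamma> x) / q > 0" using kx q by simp
            moreover have "k 0 = 0" by (simp add: k_def)
            ultimately show False by linarith
          qed
          then show "S \<inter> \<real>\<^sub>\<le>\<^sub>0 = {}"
            by (auto simp: complex_nonpos_Reals_iff S_def complex_eq_iff)
          fix w assume "w \<in> S"
          then have "k w < q * k (\<gamma> x)" using d(2)[of w] by (simp add: S_def dist_commute)
          moreover have "norm w powr (\<beta> - 1) = k w"
            by (simp add: \<beta>_def k_def powr_minus_divide)
          ultimately show "norm w powr (\<beta> - 1) \<le> q * k (\<gamma> x)" by simp
        qed (use near' st in auto)
        also have "\<dots> \<le> \<bar>\<beta>\<bar> * (q * k (\<gamma> x)) * norm (g t - g s)"
          unfolding \<gamma>_def using norm_half_plane_map_diff_le[OF u, of "g t" "g s"] q kx \<beta>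
          by (intro mult_left_mono) (auto simp: \<gamma>_def)
        \<comment> \<open>The derivative bound \<open>q * k\<close> is traded for the lower bound
          \<open>k / q\<close> of the weight along the piece; their quotient is the factor
          \<open>q * q\<close>.\<close>
        also have "\<dots> = q * q * \<beta> * (k (\<gamma> x) / q * norm (g t - g s))"
          using q \<beta> by simp
        finally have "ennreal (norm (\<psi> t - \<psi> s)) \<le> ennreal (q * q * \<beta>) * (ennreal (k (\<gamma> x) / q) * ennreal (norm (g t - g s)))"
          using q \<beta> kx by (simp add: ennreal_leI flip: ennreal_mult)
        also have "\<dots> \<le> ennreal (q * q * \<beta>) * (ennreal (k (\<gamma> x) / q) * curve_variation g s t)"
          using st by (intro mult_left_mono norm_diff_le_curve_variation) auto
        also have "\<dots> \<le> ennreal (q * q * \<beta>) * emeasure \<nu> {s<..t}"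
          unfolding \<nu>_def using st * near'
          by (intro mult_left_mono emeasure_weighted_arclength_ge[OF f g(1)]) auto
        finally show "ennreal (norm (\<psi> t - \<psi> s)) \<le> ennreal (q * q * \<beta>) * emeasure \<nu> {s<..t}" .
      qed
      then show ?case using \<open>\<delta> > 0\<close> by blast
    qed
    then show ?thesis
      using q \<beta> by (simp add: P_def ennreal_mult mult.assoc)
  qed
  have "ennreal (norm (\<psi> 1 - \<psi> 0)) \<le> ennreal \<beta> * emeasure \<nu> {0<..1}"
    using main by (rule ennreal_le_of_le_mult_gt_1)
  then have "ennreal (1 / \<beta>) * ennreal (norm (\<psi> 1 - \<psi> 0))
      \<le> ennreal (1 / \<beta>) * (ennreal \<beta> * emeasure \<nu> {0<..1})"
    by (rule mult_left_mono) simp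
  also have "\<dots> = emeasure \<nu> {0<..1}"
    using \<beta> by (simp add: ennreal_mult[symmetric] flip: mult.assoc)
  also have "\<dots> = arclength_integral f g"
    unfolding \<nu>_def by (rule arclength_integral_eq[OF f g(1), symmetric])
  also have "ennreal (1 / \<beta>) * ennreal (norm (\<psi> 1 - \<psi> 0)) = ennreal (norm (\<psi> 1 - \<psi> 0) / \<beta>)"
    using \<beta> by (simp flip: ennreal_mult)
  finally show ?thesis
    by (simp add: \<psi>_def \<gamma>_def f_def \<beta>_def pathstart_def pathfinish_def)
qed

subsection \<open>The upper bound\<close>

text \<open>\<open>v\<close> is the normalised part of \<open>y\<close> perpendicular to
  \<open>x\<close>. If that part vanishes, the sine is 0 and any unit vector orthogonal to
  \<open>u\<close> will do; the dimension hypothesis supplies one.\<close>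

lemma exists_unit_orthogonal_decomposition:
  fixes x y :: "'a::euclidean_space"
  assumes dim: "DIM('a) \<ge> 2" and "x \<noteq> 0" "y \<noteq> 0"
  defines "u \<equiv> x /\<^sub>R norm x"
  obtains v where "norm v = 1" "u \<bullet> v = 0"
    "y = norm y *\<^sub>R (cos (vangle x y) *\<^sub>R u + sin (vangle x y) *\<^sub>R v)"
proof -
  define w where "w = y - (y \<bullet> u) *\<^sub>R u"
  have u: "norm u = 1" using assms by simp
  have w: "norm w = norm y * sin (vangle x y)" and c: "y \<bullet> u = norm y * cos (vangle x y)"
    using norm_perp_eq_norm_sin_vangle[OF assms(2,3)] inner_eq_norm_cos_vangle[OF assms(2,3)]
    unfolding w_def u_def by auto
  have y: "y = norm y *\<^sub>R cos (vangle x y) *\<^sub>R u + w"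
    using c by (simp add: w_def)
  show ?thesis
  proof (cases "w = 0")
    case True
    then have s: "sin (vangle x y) = 0" using w assms by simp
    obtain z where z: "z \<noteq> 0" "orthogonal u z"
      using orthogonal_to_vector_exists[OF dim] by blast
    show ?thesis
    proof (rule that[of "z /\<^sub>R norm z"])
      show "norm (z /\<^sub>R norm z) = 1" "u \<bullet> (z /\<^sub>R norm z) = 0"
        using z by (simp_all add: orthogonal_def)
      show "y = norm y *\<^sub>R (cos (vangle x y) *\<^sub>R u + sin (vangle x y) *\<^sub>R (z /\<^sub>R norm z))"
        using y True s by simp
    qed
  next
    case False
    have "u \<bullet> u = 1" using u by (simp add: dot_square_norm)
    then have "u \<bullet> w = 0"
      by (simp add: w_def inner_diff_right inner_commute)
    show ?thesis
    proof (rule that[of "w /\<^sub>R norm w"])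
      show "norm (w /\<^sub>R norm w) = 1" "u \<bullet> (w /\<^sub>R norm w) = 0"
        using False \<open>u \<bullet> w = 0\<close> by simp_all
      have "norm y *\<^sub>R sin (vangle x y) *\<^sub>R (w /\<^sub>R norm w) = (norm y * sin (vangle x y) / norm w) *\<^sub>R w"
        by (simp add: divide_inverse)
      also have "\<dots> = w"
        using False by (simp flip: w)
      finally have "norm y *\<^sub>R sin (vangle x y) *\<^sub>R (w /\<^sub>R norm w) = w" .
      then show "y = norm y *\<^sub>R (cos (vangle x y) *\<^sub>R u + sin (vangle x y) *\<^sub>R (w /\<^sub>R norm w))"
        using y by (simp only: scaleR_add_right)
    qed
  qed
qed

lemma norm_orthonormal_combination:
  assumes "norm u = 1" "norm v = 1" "u \<bullet> v = 0"
  shows "norm (a *\<^sub>R u + b *\<^sub>R v) = sqrt (a\<^sup>2 + b\<^sup>2)"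
proof -
  have "u \<bullet> u = 1" "v \<bullet> v = 1" "v \<bullet> u = 0"
    using assms by (simp_all add: dot_square_norm inner_commute)
  then show ?thesis
    using assms unfolding norm_eq_sqrt_inner by (simp add: inner_add_left inner_add_right power2_eq_square)
qed

lemma exists_path_arclength_integral_le:
  fixes x y :: "'a::euclidean_space"
  assumes dim: "DIM('a) \<ge> 2" and \<alpha>: "0 < \<alpha>" "\<alpha> < 1" and xy: "x \<noteq> 0" "y \<noteq> 0"
  defines "\<beta> \<equiv> 1 - \<alpha>"
  obtains g where "rectifiable_path g" "pathstart g = x" "pathfinish g = y" "path_image g \<subseteq> - {0}"
    "arclength_integral (\<lambda>z. 1 / norm z powr \<alpha>) g
       \<le> ennreal (norm (of_real (norm y powr \<beta>) * cis (\<beta> * (vangle x y / 2))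
                      - of_real (norm x powr \<beta>) * cis (- (\<beta> * (vangle x y / 2)))) / \<beta>)"
proof -
  define \<theta> where "\<theta> = vangle x y"
  define u where "u = x /\<^sub>R norm x"
  obtain v where v: "norm v = 1" "u \<bullet> v = 0" and y: "y = norm y *\<^sub>R (cos \<theta> *\<^sub>R u + sin \<theta> *\<^sub>R v)"
    using exists_unit_orthogonal_decomposition[OF dim xy] unfolding u_def \<theta>_def by blast
  have u: "norm u = 1" and x: "x = norm x *\<^sub>R u" using xy by (simp_all add: u_def)
  have \<theta>: "0 \<le> \<theta>" "\<theta> \<le> pi" using vangle_bounds[OF xy] by (simp_all add: \<theta>_def)
  have \<beta>: "0 < \<beta>" "\<beta> < 1" using \<alpha> by (simp_all add: \<beta>_def)
  \<comment> \<open>\<open>A\<close> and \<open>B\<close> are the flattened positions of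
    \<open>x\<close> and \<open>y\<close>, with the bisector of their angle on the positive real
    axis.\<close>
  define A where "A = of_real (norm x powr \<beta>) * cis (- (\<beta> * (\<theta> / 2)))"
  define B where "B = of_real (norm y powr \<beta>) * cis (\<beta> * (\<theta> / 2))"
  define D where "D = norm (B - A)"
  \<comment> \<open>An isometric embedding of the complex plane onto the span of \<open>u\<close>
    and \<open>v\<close>. In \<open>g\<close>, the factor \<open>cis (\<theta> / 2)\<close> undoes
    the rotation that centred the sector.\<close>
  define J where "J w = Re w *\<^sub>R u + Im w *\<^sub>R v" for w
  define \<zeta> where "\<zeta> t = A + of_real t * (B - A)" for t :: real
  define p where "p = 1 / \<beta>"
  define g where "g t = J (cis (\<theta> / 2) * \<zeta> t powr of_real p)" for t
  have J: "norm (J w) = norm w" for w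
    unfolding J_def cmod_def by (rule norm_orthonormal_combination[OF u v])
  have Jdiff: "J w - J z = J (w - z)" for w z
    by (simp add: J_def algebra_simps)
  have small: "\<beta> * (\<theta> / 2) < pi / 2" "0 \<le> \<beta> * (\<theta> / 2)"
  proof -
    have "\<beta> * (\<theta> / 2) \<le> \<beta> * (pi / 2)" using \<theta> \<beta> by (intro mult_left_mono) auto
    also have "\<dots> < pi / 2" using \<beta> by simp
    finally show "\<beta> * (\<theta> / 2) < pi / 2" .
    show "0 \<le> \<beta> * (\<theta> / 2)" using \<theta> \<beta> by simp
  qed
  have "cos (\<beta> * (\<theta> / 2)) > 0" using small by (intro cos_gt_zero_pi) auto
  then have ReA: "Re A > 0" "Re B > 0"
    using xy by (simp_all add: A_def B_def)
  have \<zeta>_eq: "\<zeta> t = (1 - t) *\<^sub>R A + t *\<^sub>R B" for t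
    by (simp add: \<zeta>_def scaleR_conv_of_real algebra_simps)
  have Re_pos: "Re (\<zeta> t) > 0" if "t \<in> {0..1}" for t
    using that ReA convexD_alt[OF convex_halfspace_Re_gt[of 0], of A B t]
    unfolding \<zeta>_eq by simp
  have \<zeta>_diff: "norm (\<zeta> t - \<zeta> s) = \<bar>t - s\<bar> * D" for s t
  proof -
    have "\<zeta> t - \<zeta> s = of_real (t - s) * (B - A)" by (simp add: \<zeta>_def algebra_simps)
    then show ?thesis by (simp add: norm_mult D_def del: of_real_diff)
  qed
  have norm_g: "norm (g t) = norm (\<zeta> t) powr p" for t
    unfolding g_def J norm_mult by (subst norm_powr_real_powr') auto
  have g_diff: "norm (g t - g s) = norm (\<zeta> t powr of_real p - \<zeta> s powr of_real p)" for s t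
    unfolding g_def Jdiff J by (simp add: norm_mult flip: right_diff_distrib)
  have g0: "g 0 = x"
  proof -
    have "\<zeta> 0 powr of_real p = of_real ((norm x powr \<beta>) powr p) * cis (p * (- (\<beta> * (\<theta> / 2))))"
      unfolding \<zeta>_def A_def using small xy by (simp add: powr_of_real_mult_cis del: mult_minus_right)
    also have "\<dots> = of_real (norm x) * cis (- (\<theta> / 2))"
      using \<beta> by (simp add: p_def powr_powr)
    finally have "cis (\<theta> / 2) * \<zeta> 0 powr of_real p = of_real (norm x) * (cis (\<theta> / 2) * cis (- (\<theta> / 2)))"
      by simp
    then have "g 0 = norm x *\<^sub>R u"
      unfolding g_def J_def cis_mult by simp
    then show ?thesis using x by simp
  qed
  have g1: "g 1 = y"
  proof -
    have "\<zeta> 1 powr of_real p = of_real ((norm y powr \<beta>) powr p) * cis (p * (\<beta> * (\<theta> / 2)))"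
      unfolding \<zeta>_def B_def using small xy by (simp add: powr_of_real_mult_cis)
    also have "\<dots> = of_real (norm y) * cis (\<theta> / 2)"
      using \<beta> by (simp add: p_def powr_powr)
    finally have "cis (\<theta> / 2) * \<zeta> 1 powr of_real p = of_real (norm y) * (cis (\<theta> / 2) * cis (\<theta> / 2))"
      by simp
    then have "g 1 = norm y *\<^sub>R (cos \<theta> *\<^sub>R u + sin \<theta> *\<^sub>R v)"
      unfolding g_def J_def cis_mult by (simp add: scaleR_add_right)
    then show ?thesis using y by simp
  qed
  \<comment> \<open>\<open>S\<close> and \<open>C\<close> stay free because two uses follow: a crude
    global bound giving rectifiability, and a sharp local one for the length.\<close>
  have Lip: "curve_variation g s t \<le> ennreal (p * C * D * (t - s))"
    if S: "convex S" "S \<inter> \<real>\<^sub>\<le>\<^sub>0 = {}" "\<And>w. w \<in> S \<Longrightarrow> norm w powr (p - 1) \<le> C"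
      and st: "s \<le> t" "\<And>r. s \<le> r \<Longrightarrow> r \<le> t \<Longrightarrow> \<zeta> r \<in> S" for S C s t
  proof (rule curve_variation_Lipschitz[OF \<open>s \<le> t\<close>])
    fix r r' assume r: "s \<le> r" "r \<le> r'" "r' \<le> t"
    have "norm (g r' - g r) \<le> \<bar>p\<bar> * C * norm (\<zeta> r' - \<zeta> r)"
      unfolding g_diff using r st by (intro norm_diff_powr_le[OF S(1,2)] S(3)) auto
    then show "norm (g r' - g r) \<le> p * C * D * (r' - r)"
      unfolding \<zeta>_diff using r \<beta> by (simp add: p_def mult_ac)
  qed
  have pathg: "path g"
    unfolding path_def g_def J_def \<zeta>_def
    using Re_pos unfolding \<zeta>_def
    by (intro continuous_intros continuous_on_powr_complex)
       (fastforce simp: complex_nonpos_Reals_iff)+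
  \<comment> \<open>A ball about 0 containing both ends contains the chord, and \<open>p - 1\<close>
    is positive, so the derivative is largest on its boundary.\<close>
  have "curve_variation g 0 1 \<le> ennreal (p * (max (norm A) (norm B) powr (p - 1)) * D * (1 - 0))"
  proof (rule Lip[of "{w. Re w > 0} \<inter> cball 0 (max (norm A) (norm B))"])
    show "convex ({w. Re w > 0} \<inter> cball 0 (max (norm A) (norm B)))"
      by (intro convex_Int convex_halfspace_Re_gt convex_cball)
    show "{w. Re w > 0} \<inter> cball 0 (max (norm A) (norm B)) \<inter> \<real>\<^sub>\<le>\<^sub>0 = {}"
      by (auto simp: complex_nonpos_Reals_iff)
    show "norm w powr (p - 1) \<le> max (norm A) (norm B) powr (p - 1)"
      if "w \<in> {w. Re w > 0} \<inter> cball 0 (max (norm A) (norm B))" for w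
      using that \<beta> by (intro powr_mono2) (auto simp: p_def)
    fix r :: real assume r: "0 \<le> r" "r \<le> 1"
    then have "\<zeta> r \<in> cball 0 (max (norm A) (norm B))"
      unfolding \<zeta>_eq using r
      by (intro convexD_alt[OF convex_cball]) auto
    then show "\<zeta> r \<in> {w. Re w > 0} \<inter> cball 0 (max (norm A) (norm B))"
      using Re_pos r by auto
  qed simp
  then have "curve_variation g 0 1 < \<infinity>"
    by (rule le_less_trans) simp
  then have rect: "rectifiable_path g"
    using pathg by (simp add: rectifiable_path_def)
  have "g t \<noteq> 0" if "t \<in> {0..1}" for t
  proof -
    have "\<zeta> t \<noteq> 0" using Re_pos[OF that] by auto
    then show ?thesis using norm_g[of t] by auto
  qed
  then have img: "path_image g \<subseteq> - {0}"
    by (auto simp: path_image_def)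
  define f where "f = (\<lambda>z::'a. 1 / norm z powr \<alpha>)"
  define k where "k = (\<lambda>w::complex. norm w powr (p - 1))"
  define \<nu> where "\<nu> = weighted_arclength f g"
  have f: "continuous_on (path_image g) f"
    unfolding f_def using img by (auto intro!: continuous_intros)
  have fk: "f (g t) = 1 / k (\<zeta> t)" for t
  proof -
    \<comment> \<open>This identity makes the weight at \<open>g t\<close> the exact reciprocal of
      the derivative factor \<open>k\<close> of the inverse power map at
      \<open>\<zeta> t\<close>.\<close>
    have "p * \<alpha> = p - 1" using \<beta> by (simp add: p_def \<beta>_def field_simps)
    then show ?thesis by (simp add: f_def k_def norm_g powr_powr)
  qed
  have main: "emeasure \<nu> {0<..1} \<le> ennreal (q * q) * ennreal (p * D)" if q: "q > 1" for q :: real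
  proof -
    define P where "P s t \<longleftrightarrow> (0 \<le> s \<and> t \<le> 1 \<longrightarrow>
        emeasure \<nu> {s<..t} \<le> ennreal (q * q * p * D * (t - s)))" for s t
    have pD: "q * q * p * D \<ge> 0" using q \<beta> by (simp add: p_def D_def)
    have "(0::real) \<le> 1" by simp
    then have "P 0 1"
    proof (induction rule: Bolzano)
      case (trans a b c)
      show ?case unfolding P_def
      proof
        assume *: "0 \<le> a \<and> c \<le> 1"
        have "emeasure \<nu> {a<..c} = emeasure \<nu> {a<..b} + emeasure \<nu> {b<..c}"
          using trans unfolding \<nu>_def by (simp add: emeasure_weighted_arclength_add)
        also have "\<dots> \<le> ennreal (q * q * p * D * (b - a)) + ennreal (q * q * p * D * (c - b))"
          using trans * unfolding P_def by (intro add_mono) auto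
        also have "\<dots> = ennreal (q * q * p * D * (b - a) + q * q * p * D * (c - b))"
          using pD trans by (intro ennreal_plus[symmetric] mult_nonneg_nonneg[OF pD]) auto
        also have "q * q * p * D * (b - a) + q * q * p * D * (c - b) = q * q * p * D * (c - a)"
          by (simp add: algebra_simps)
        finally show "emeasure \<nu> {a<..c} \<le> ennreal (q * q * p * D * (c - a))" .
      qed
    next
      case (local x)
      then have \<zeta>x: "\<zeta> x \<noteq> 0" using Re_pos[of x] by auto
      then have kx: "k (\<zeta> x) > 0" by (simp add: k_def)
      have "isCont k (\<zeta> x)"
        unfolding k_def using \<zeta>x by (intro continuous_intros) auto
      then obtain d where d: "d > 0"
          "\<And>w. dist w (\<zeta> x) < d \<Longrightarrow> k (\<zeta> x) / q < k w \<and> k w < q * k (\<zeta> x)"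
        using continuous_pos_ratio_near kx q by metis
      \<comment> \<open>The chord is traversed at speed \<open>D\<close>; adding 1 covers the
        degenerate case \<open>D = 0\<close>.\<close>
      define \<delta> where "\<delta> = d / (D + 1)"
      have D: "D \<ge> 0" by (simp add: D_def)
      then have \<delta>: "\<delta> > 0" using d by (simp add: \<delta>_def)
      have near: "dist (\<zeta> t) (\<zeta> x) < d" if "\<bar>t - x\<bar> < \<delta>" for t
      proof -
        have "\<bar>t - x\<bar> * D \<le> \<bar>t - x\<bar> * (D + 1)" by (intro mult_left_mono) auto
        also have "\<dots> < d" using that D by (simp add: \<delta>_def field_simps)
        finally show ?thesis by (simp add: dist_norm \<zeta>_diff)
      qed
      define S where "S = {w. Re w > 0} \<inter> ball (\<zeta> x) d"
      have "P s t" if st: "s \<le> x" "x \<le> t" "t - s < \<delta>" for s t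
        unfolding P_def
      proof
        assume *: "0 \<le> s \<and> t \<le> 1"
        have n: "dist (\<zeta> r) (\<zeta> x) < d" if "s \<le> r" "r \<le> t" for r
          using that st by (intro near) auto
        have cv: "curve_variation g s t \<le> ennreal (p * (q * k (\<zeta> x)) * D * (t - s))"
        proof (rule Lip[of S])
          show "convex S"
            unfolding S_def by (intro convex_Int convex_halfspace_Re_gt convex_ball)
          show "S \<inter> \<real>\<^sub>\<le>\<^sub>0 = {}"
            by (auto simp: S_def complex_nonpos_Reals_iff)
          show "norm w powr (p - 1) \<le> q * k (\<zeta> x)" if "w \<in> S" for w
            using d(2)[of w] that by (simp add: S_def k_def dist_commute)
          show "\<zeta> r \<in> S" if "s \<le> r" "r \<le> t" for r
            using n[OF that] Re_pos[of r] that * by (auto simp: S_def dist_commute)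
        qed (use st in auto)
        have "emeasure \<nu> {s<..t} \<le> ennreal (q / k (\<zeta> x)) * curve_variation g s t"
          unfolding \<nu>_def
        proof (rule emeasure_weighted_arclength_le[OF f rect])
          fix r assume r: "s \<le> r" "r \<le> t"
          have lt: "k (\<zeta> x) / q < k (\<zeta> r)" using d(2)[OF n[OF r]] by simp
          have "0 < k (\<zeta> x) / q" using kx q by simp
          then have "1 / k (\<zeta> r) \<le> 1 / (k (\<zeta> x) / q)"
            using lt by (intro frac_le) auto
          then show "f (g r) \<le> q / k (\<zeta> x)" by (simp add: fk)
        qed (use st * in auto)
        also have "\<dots> \<le> ennreal (q / k (\<zeta> x)) * ennreal (p * (q * k (\<zeta> x)) * D * (t - s))"
          using cv by (rule mult_left_mono) simp
        also have "\<dots> = ennreal (q / k (\<zeta> x) * (p * (q * k (\<zeta> x)) * D * (t - s)))"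
          using kx q D \<beta> st by (intro ennreal_mult[symmetric]) (auto simp: p_def)
        also have "q / k (\<zeta> x) * (p * (q * k (\<zeta> x)) * D * (t - s)) = q * q * p * D * (t - s)"
          using kx by (simp add: field_simps)
        finally show "emeasure \<nu> {s<..t} \<le> ennreal (q * q * p * D * (t - s))" .
      qed
      then show ?case using \<delta> by blast
    qed
    then show ?thesis
      using q \<beta> by (simp add: P_def D_def p_def mult.assoc flip: ennreal_mult)
  qed
  have "emeasure \<nu> {0<..1} \<le> ennreal (p * D)"
    using main by (rule ennreal_le_of_le_mult_gt_1)
  also have "p * D = norm (B - A) / \<beta>" by (simp add: p_def D_def)
  also have "emeasure \<nu> {0<..1} = arclength_integral f g"
    unfolding \<nu>_def by (rule arclength_integral_eq[OF f rect, symmetric])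
  finally have "arclength_integral f g \<le> ennreal (norm (B - A) / \<beta>)" .
  then show ?thesis
    using that[OF rect _ _ img] g0 g1 unfolding f_def A_def B_def \<theta>_def pathstart_def pathfinish_def
    by simp
qed

subsection \<open>The distance formula and its limit\<close>

lemma k_alpha_eq:
  fixes x y :: "'a::euclidean_space"
  assumes dim: "DIM('a) \<ge> 2" and \<alpha>: "0 < \<alpha>" "\<alpha> < 1" and xy: "x \<noteq> 0" "y \<noteq> 0"
  shows "k_alpha \<alpha> x y =
           (1 / (1 - \<alpha>)) * sqrt (norm x powr (2 * (1 - \<alpha>)) + norm y powr (2 * (1 - \<alpha>))
              - 2 * norm x powr (1 - \<alpha>) * norm y powr (1 - \<alpha>) * cos ((1 - \<alpha>) * vangle x y))"
    (is "_ = ?rhs")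
proof -
  define \<beta> where "\<beta> = 1 - \<alpha>"
  define \<theta> where "\<theta> = vangle x y"
  define u where "u = x /\<^sub>R norm x"
  define paths where "paths = {g. rectifiable_path g \<and> pathstart g = x \<and> pathfinish g = y
                                        \<and> path_image g \<subseteq> - {0}}"
  define R where "R = sqrt (norm x powr (2 * \<beta>) + norm y powr (2 * \<beta>)
              - 2 * norm x powr \<beta> * norm y powr \<beta> * cos (\<beta> * \<theta>)) / \<beta>"
  have u: "norm u = 1" using xy by (simp add: u_def)
  have sq: "(norm z powr \<beta>)\<^sup>2 = norm z powr (2 * \<beta>)" for z :: 'a
    by (simp add: power2_eq_square flip: powr_add)
  \<comment> \<open>By the law of cosines only the difference of the arguments matters, so the
    half-plane and bisector normalisations yield the same \<open>R\<close>.\<close>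
  have polar: "norm (of_real (norm y powr \<beta>) * cis s - of_real (norm x powr \<beta>) * cis t) / \<beta> = R"
    if "cos (s - t) = cos (\<beta> * \<theta>)" for s t
    by (subst norm_diff_polar) (simp_all add: R_def sq that algebra_simps)
  have H: "half_plane_map u z powr of_real \<beta>
      = of_real (norm z powr \<beta>) * cis (\<beta> * (pi / 2 - vangle x z))" if z: "z \<noteq> 0" for z
  proof -
    have "- pi < pi / 2 - vangle x z" "pi / 2 - vangle x z \<le> pi"
      using vangle_bounds[OF xy(1) z] pi_gt_zero by linarith+
    then show ?thesis
      unfolding u_def half_plane_map_eq_polar[OF xy(1) z] using z
      by (simp add: powr_of_real_mult_cis)
  qed
  have xx: "vangle x x = 0"
    using xy by (simp add: vangle_def dot_square_norm power2_eq_square)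
  have lower: "ennreal R \<le> arclength_integral (\<lambda>z. 1 / norm z powr \<alpha>) g" if "g \<in> paths" for g
  proof -
    have g: "rectifiable_path g" "pathstart g = x" "pathfinish g = y" "path_image g \<subseteq> - {0}"
      using that by (auto simp: paths_def)
    have "cos (\<beta> * (pi / 2 - \<theta>) - \<beta> * (pi / 2 - 0)) = cos (\<beta> * \<theta>)"
      by (simp add: algebra_simps)
    then show ?thesis
      using arclength_integral_ge[OF \<alpha> g(1,4) u]
      unfolding g(2,3) \<beta>_def[symmetric] H[OF xy(1)] H[OF xy(2)] xx \<theta>_def[symmetric]
      by (simp add: polar)
  qed
  obtain g where g: "g \<in> paths"
      and "arclength_integral (\<lambda>z. 1 / norm z powr \<alpha>) g
       \<le> ennreal (norm (of_real (norm y powr \<beta>) * cis (\<beta> * (\<theta> / 2))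
                      - of_real (norm x powr \<beta>) * cis (- (\<beta> * (\<theta> / 2)))) / \<beta>)"
    using exists_path_arclength_integral_le[OF dim \<alpha> xy] unfolding paths_def \<beta>_def \<theta>_def by blast
  then have upper: "arclength_integral (\<lambda>z. 1 / norm z powr \<alpha>) g \<le> ennreal R"
    by (subst (asm) polar) (simp_all add: field_simps)
  have "(INF g\<in>paths. arclength_integral (\<lambda>z. 1 / norm z powr \<alpha>) g) = ennreal R"
  proof (rule antisym)
    show "(INF g\<in>paths. arclength_integral (\<lambda>z. 1 / norm z powr \<alpha>) g) \<le> ennreal R"
      using INF_lower[OF g, of "arclength_integral (\<lambda>z. 1 / norm z powr \<alpha>)"] upper by (rule order_trans)
  qed (intro INF_greatest lower)
  moreover have "R \<ge> 0"
    by (subst polar[of "\<beta> * \<theta>" 0, symmetric]) (use \<alpha> in \<open>simp_all add: \<beta>_def\<close>)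
  ultimately show ?thesis
    unfolding k_alpha_def paths_def[symmetric] by (simp add: R_def \<beta>_def \<theta>_def)
qed

text \<open>With b = 1 - a, the radicand is the square of \<open>r powr b - s powr b\<close> plus
  \<open>2 * r powr b * s powr b * (1 - cos (b * \<theta>))\<close>. Divided by the square of b, the
  two terms tend to the square of \<open>ln (r / s)\<close> and to that of \<theta>.\<close>

lemma cone_distance_tendsto:
  fixes r s \<theta> :: real
  assumes "r > 0" "s > 0"
  shows "((\<lambda>a. (1 / (1 - a)) * sqrt (r powr (2 * (1 - a)) + s powr (2 * (1 - a))
              - 2 * r powr (1 - a) * s powr (1 - a) * cos ((1 - a) * \<theta>)))
           \<longlongrightarrow> sqrt (\<theta>\<^sup>2 + (ln (r / s))\<^sup>2)) (at_left 1)"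
proof -
  have 1: "((\<lambda>a. (r powr (1 - a) - s powr (1 - a)) / (1 - a)) \<longlongrightarrow> ln r - ln s) (at_left 1)"
    using assms by real_asymp
  have 2: "((\<lambda>a. (1 - cos ((1 - a) * \<theta>)) / (1 - a)\<^sup>2) \<longlongrightarrow> \<theta>\<^sup>2 / 2) (at_left 1)"
    unfolding power2_eq_square[of \<theta>] by real_asymp
  have 3: "((\<lambda>a. r powr (1 - a) * s powr (1 - a)) \<longlongrightarrow> 1) (at_left 1)"
    using assms by real_asymp
  have lim: "((\<lambda>a. sqrt (((r powr (1 - a) - s powr (1 - a)) / (1 - a))\<^sup>2
          + 2 * (r powr (1 - a) * s powr (1 - a)) * ((1 - cos ((1 - a) * \<theta>)) / (1 - a)\<^sup>2)))
        \<longlongrightarrow> sqrt ((ln r - ln s)\<^sup>2 + 2 * 1 * (\<theta>\<^sup>2 / 2))) (at_left 1)"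
    by (intro tendsto_intros 1 2 3)
  have lim_eq: "sqrt ((ln r - ln s)\<^sup>2 + 2 * 1 * (\<theta>\<^sup>2 / 2)) = sqrt (\<theta>\<^sup>2 + (ln (r / s))\<^sup>2)"
    using assms by (simp add: ln_div add.commute)
  have ev: "eventually (\<lambda>a::real.
      sqrt (((r powr (1 - a) - s powr (1 - a)) / (1 - a))\<^sup>2
          + 2 * (r powr (1 - a) * s powr (1 - a)) * ((1 - cos ((1 - a) * \<theta>)) / (1 - a)\<^sup>2))
      = (1 / (1 - a)) * sqrt (r powr (2 * (1 - a)) + s powr (2 * (1 - a))
              - 2 * r powr (1 - a) * s powr (1 - a) * cos ((1 - a) * \<theta>))) (at_left 1)"
  proof (rule eventually_at_leftI[of 0])
    fix a :: real assume "a \<in> {0<..<1}"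
    define b where "b = 1 - a"
    have b: "b > 0" using \<open>a \<in> {0<..<1}\<close> by (simp add: b_def)
    have sq: "t powr (2 * b) = (t powr b)\<^sup>2" for t
      by (simp add: power2_eq_square flip: powr_add)
    have "((r powr b - s powr b) / b)\<^sup>2 + 2 * (r powr b * s powr b) * ((1 - cos (b * \<theta>)) / b\<^sup>2)
        = (r powr (2 * b) + s powr (2 * b) - 2 * r powr b * s powr b * cos (b * \<theta>)) / b\<^sup>2"
      unfolding sq using b by (simp add: field_simps power2_eq_square)
    then show "sqrt (((r powr (1 - a) - s powr (1 - a)) / (1 - a))\<^sup>2
          + 2 * (r powr (1 - a) * s powr (1 - a)) * ((1 - cos ((1 - a) * \<theta>)) / (1 - a)\<^sup>2))
      = (1 / (1 - a)) * sqrt (r powr (2 * (1 - a)) + s powr (2 * (1 - a))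
              - 2 * r powr (1 - a) * s powr (1 - a) * cos ((1 - a) * \<theta>))"
      unfolding b_def[symmetric] using b by (simp add: real_sqrt_divide)
  qed simp
  show ?thesis
    using Lim_transform_eventually[OF lim ev] unfolding lim_eq .
qed

theorem theorem1p4:
  fixes x y :: "'a::euclidean_space" and \<alpha> :: real
  assumes "DIM('a) \<ge> 2" and "0 < \<alpha>" and "\<alpha> < 1"
    and "x \<noteq> 0" and "y \<noteq> 0"
  shows "(k_alpha \<alpha> x y =
           (1 / (1 - \<alpha>)) * sqrt (norm x powr (2 * (1 - \<alpha>)) + norm y powr (2 * (1 - \<alpha>))
              - 2 * norm x powr (1 - \<alpha>) * norm y powr (1 - \<alpha>) * cos ((1 - \<alpha>) * vangle x y))) \<and>
         ((\<lambda>a. k_alpha a x y) \<longlongrightarrow> sqrt ((vangle x y)\<^sup>2 + (ln (norm x / norm y))\<^sup>2)) (at_left 1)"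
proof
  show "k_alpha \<alpha> x y =
           (1 / (1 - \<alpha>)) * sqrt (norm x powr (2 * (1 - \<alpha>)) + norm y powr (2 * (1 - \<alpha>))
              - 2 * norm x powr (1 - \<alpha>) * norm y powr (1 - \<alpha>) * cos ((1 - \<alpha>) * vangle x y))"
    using assms by (rule k_alpha_eq)
  \<comment> \<open>The closed form is available for exponents strictly between 0 and 1, which
    suffices for a limit from the left.\<close>
  have "eventually (\<lambda>a. k_alpha a x y =
           (1 / (1 - a)) * sqrt (norm x powr (2 * (1 - a)) + norm y powr (2 * (1 - a))
              - 2 * norm x powr (1 - a) * norm y powr (1 - a) * cos ((1 - a) * vangle x y))) (at_left 1)"
    by (rule eventually_at_leftI[of 0], rule k_alpha_eq) (use assms in auto)
  then show "((\<lambda>a. k_alpha a x y) \<longlongrightarrow> sqrt ((vangle x y)\<^sup>2 + (ln (norm x / norm y))\<^sup>2)) (at_left 1)"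
    using cone_distance_tendsto[of "norm x" "norm y" "vangle x y"] assms
    by (subst tendsto_cong) auto
qed

end
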